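(* Let $\mathbb L$ be the Lie algebra over $\mathbb C$ defined by generators $A_i,A_i^*$ $(i\in\{1,2,3\})$ and the following relations. (i) For distinct $i,j\in\{1,2,3\}$: $[A_i,A_j]=0$ and $[A_i^*,A_j^*]=0$. (ii) For $i\in\{1,2,3\}$: $[A_i,A_i^*]=0$. (iii) For distinct $i,j\in\{1,2,3\}$: $[A_i,[A_i,A_j^*]]=4A_j^*$ and $[A_j^*,[A_j^*,A_i]]=4A_i$. (iv) For mutually distinct $h,i,j\in\{1,2,3\}$: $$[A_h,[A_i^*,A_j]]=[A_h^*,[A_i,A_j^*]]=[A_j,[A_i^*,A_h]]=[A_j^*,[A_i,A_h^*]].$$ Then there exists a Lie algebra isomorphism $\sharp:\mathbb L\to\mathfrak{sl}_4(\mathbb C)$ that sends $$A_1\mapsto\begin{pmatrix}0&1&0&0\\1&0&0&0\\0&0&0&1\\0&0&1&0\end{pmatrix},\quad A_2\mapsto\begin{pmatrix}0&0&1&0\\0&0&0&1\\1&0&0&0\\0&1&0&0\end{pmatrix},\quad A_3\mapsto\begin{pmatrix}0&0&0&1\\0&0&1&0\\0&1&0&0\\1&0&0&0\end{pmatrix},$$ $$A_1^*\mapsto{\rm diag}(1,1,-1,-1),\quad A_2^*\mapsto{\rm diag}(1,-1,1,-1),\quad A_3^*\mapsto{\rm diag}(1,-1,-1,1).$$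
   Context: $\mathfrak{sl}_4(\mathbb C)$ is the Lie algebra of trace-zero $4\times 4$ complex matrices with bracket $[\varphi,\phi]=\varphi\phi-\phi\varphi$. *)

theory Defs
  imports "HOL-Analysis.Analysis"
begin

section \<open>Lie algebras\<close>

locale lie_algebra = vector_space scale
  for scale :: "'k::field \<Rightarrow> 'a::ab_group_add \<Rightarrow> 'a" +
  fixes bracket :: "'a \<Rightarrow> 'a \<Rightarrow> 'a"
  assumes bracket_add_left: "bracket (x + y) z = bracket x z + bracket y z"
    and bracket_add_right: "bracket x (y + z) = bracket x y + bracket x z"
    and bracket_scale_left: "bracket (scale c x) y = scale c (bracket x y)"
    and bracket_scale_right: "bracket x (scale c y) = scale c (bracket x y)"
    and bracket_self: "bracket x x = 0"
    and jacobi: "bracket x (bracket y z) + bracket y (bracket z x) + bracket z (bracket x y) = 0"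
begin

definition lie_subalgebra :: "'a set \<Rightarrow> bool" where
  "lie_subalgebra S \<longleftrightarrow> subspace S \<and> (\<forall>x\<in>S. \<forall>y\<in>S. bracket x y \<in> S)"

end

locale lie_hom = L1: lie_algebra s1 b1 + L2: lie_algebra s2 b2 + Vector_Spaces.linear s1 s2 f
  for s1 :: "'k::field \<Rightarrow> 'a::ab_group_add \<Rightarrow> 'a" and b1 :: "'a \<Rightarrow> 'a \<Rightarrow> 'a"
    and s2 :: "'k \<Rightarrow> 'b::ab_group_add \<Rightarrow> 'b" and b2 :: "'b \<Rightarrow> 'b \<Rightarrow> 'b"
    and f :: "'a \<Rightarrow> 'b" +
  assumes hom_bracket: "f (b1 x y) = b2 (f x) (f y)"

text \<open>An isomorphism from the Lie algebra on the whole type \<^typ>\<open>'a\<close> onto the Lie subalgebra \<open>S\<close>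
  of the Lie algebra on \<^typ>\<open>'b\<close>, where \<open>S\<close> carries the restricted operations.\<close>

locale lie_isomorphism = lie_hom s1 b1 s2 b2 f
  for s1 :: "'k::field \<Rightarrow> 'a::ab_group_add \<Rightarrow> 'a" and b1 :: "'a \<Rightarrow> 'a \<Rightarrow> 'a"
    and s2 :: "'k \<Rightarrow> 'b::ab_group_add \<Rightarrow> 'b" and b2 :: "'b \<Rightarrow> 'b \<Rightarrow> 'b"
    and S :: "'b set" and f :: "'a \<Rightarrow> 'b" +
  assumes subalgebra: "L2.lie_subalgebra S"
    and bij: "bij_betw f UNIV S"

section \<open>Lie algebras defined by generators and relations\<close>

datatype ('k, 'g) lie_term =
    Zero
  | Gen 'g
  | Add "('k, 'g) lie_term" "('k, 'g) lie_term"
  | Scale 'k "('k, 'g) lie_term"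
  | Bracket "('k, 'g) lie_term" "('k, 'g) lie_term"

text \<open>The least congruence on terms that contains the relations \<open>R\<close> and makes the quotient a
  Lie algebra; the quotient is the Lie algebra with generators \<^typ>\<open>'g\<close> and relations \<open>R\<close>.\<close>

inductive lie_cong ::
    "(('k::field, 'g) lie_term \<Rightarrow> ('k, 'g) lie_term \<Rightarrow> bool) \<Rightarrow>
      ('k, 'g) lie_term \<Rightarrow> ('k, 'g) lie_term \<Rightarrow> bool"
  for R :: "('k, 'g) lie_term \<Rightarrow> ('k, 'g) lie_term \<Rightarrow> bool"
  where
  rel: "R s t \<Longrightarrow> lie_cong R s t"
| refl: "lie_cong R t t"
| sym: "lie_cong R s t \<Longrightarrow> lie_cong R t s"
| trans: "lie_cong R s t \<Longrightarrow> lie_cong R t u \<Longrightarrow> lie_cong R s u"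
| Add_cong: "lie_cong R s s' \<Longrightarrow> lie_cong R t t' \<Longrightarrow> lie_cong R (Add s t) (Add s' t')"
| Scale_cong: "lie_cong R t t' \<Longrightarrow> lie_cong R (Scale c t) (Scale c t')"
| Bracket_cong: "lie_cong R s s' \<Longrightarrow> lie_cong R t t' \<Longrightarrow> lie_cong R (Bracket s t) (Bracket s' t')"
| Add_assoc: "lie_cong R (Add (Add s t) u) (Add s (Add t u))"
| Add_commute: "lie_cong R (Add s t) (Add t s)"
| Add_Zero: "lie_cong R (Add Zero t) t"
| Add_inverse: "lie_cong R (Add (Scale (- 1) t) t) Zero"
| Scale_Add: "lie_cong R (Scale c (Add s t)) (Add (Scale c s) (Scale c t))"
| Scale_add: "lie_cong R (Scale (c + d) t) (Add (Scale c t) (Scale d t))"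
| Scale_Scale: "lie_cong R (Scale c (Scale d t)) (Scale (c * d) t)"
| Scale_one: "lie_cong R (Scale 1 t) t"
| Bracket_Add_left: "lie_cong R (Bracket (Add s t) u) (Add (Bracket s u) (Bracket t u))"
| Bracket_Add_right: "lie_cong R (Bracket s (Add t u)) (Add (Bracket s t) (Bracket s u))"
| Bracket_Scale_left: "lie_cong R (Bracket (Scale c s) t) (Scale c (Bracket s t))"
| Bracket_Scale_right: "lie_cong R (Bracket s (Scale c t)) (Scale c (Bracket s t))"
| Bracket_self: "lie_cong R (Bracket t t) Zero"
| Jacobi: "lie_cong R
    (Add (Add (Bracket s (Bracket t u)) (Bracket t (Bracket u s))) (Bracket u (Bracket s t))) Zero"

lemma equivp_lie_cong: "equivp (lie_cong R)"
  by (intro equivpI reflpI sympI transpI) (blast intro: lie_cong.intros)+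

primrec eval_term ::
    "('k \<Rightarrow> 'a \<Rightarrow> 'a) \<Rightarrow> ('a \<Rightarrow> 'a \<Rightarrow> 'a) \<Rightarrow> ('g \<Rightarrow> 'a) \<Rightarrow> ('k, 'g) lie_term \<Rightarrow> 'a::ab_group_add"
  where
  "eval_term sc br a Zero = 0"
| "eval_term sc br a (Gen g) = a g"
| "eval_term sc br a (Add s t) = eval_term sc br a s + eval_term sc br a t"
| "eval_term sc br a (Scale c t) = sc c (eval_term sc br a t)"
| "eval_term sc br a (Bracket s t) = br (eval_term sc br a s) (eval_term sc br a t)"

lemma (in lie_algebra) eval_term_cong:
  assumes "lie_cong R s t"
    and R: "\<And>s t. R s t \<Longrightarrow> eval_term scale bracket a s = eval_term scale bracket a t"
  shows "eval_term scale bracket a s = eval_term scale bracket a t"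
  using assms(1)
  by induction
    (simp_all add: R algebra_simps scale_right_distrib scale_left_distrib bracket_add_left
      bracket_add_right bracket_scale_left bracket_scale_right bracket_self,
      metis add.assoc add.commute jacobi)

section \<open>The Lie algebra \<open>\<bbbL>\<close>\<close>

text \<open>The index set \<open>{1, 2, 3}\<close> is the numeral type \<^typ>\<open>3\<close>, whose elements are \<open>1\<close>, \<open>2\<close>
  and \<open>3\<close> (with \<open>3 = 0\<close>, as its arithmetic is modular).\<close>

datatype generator = GenA 3 | GenAstar 3

abbreviation tA :: "3 \<Rightarrow> (complex, generator) lie_term" where
  "tA i \<equiv> Gen (GenA i)"

abbreviation tAstar :: "3 \<Rightarrow> (complex, generator) lie_term" where
  "tAstar i \<equiv> Gen (GenAstar i)"

inductive L_rel :: "(complex, generator) lie_term \<Rightarrow> (complex, generator) lie_term \<Rightarrow> bool"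
  where
  A_A: "i \<noteq> j \<Longrightarrow> L_rel (Bracket (tA i) (tA j)) Zero"
| Astar_Astar: "i \<noteq> j \<Longrightarrow> L_rel (Bracket (tAstar i) (tAstar j)) Zero"
| A_Astar: "L_rel (Bracket (tA i) (tAstar i)) Zero"
| A_A_Astar:
    "i \<noteq> j \<Longrightarrow> L_rel (Bracket (tA i) (Bracket (tA i) (tAstar j))) (Scale 4 (tAstar j))"
| Astar_Astar_A:
    "i \<noteq> j \<Longrightarrow> L_rel (Bracket (tAstar j) (Bracket (tAstar j) (tA i))) (Scale 4 (tA i))"
| triple1: "h \<noteq> i \<Longrightarrow> i \<noteq> j \<Longrightarrow> h \<noteq> j \<Longrightarrow>
    L_rel (Bracket (tA h) (Bracket (tAstar i) (tA j)))
          (Bracket (tAstar h) (Bracket (tA i) (tAstar j)))"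
| triple2: "h \<noteq> i \<Longrightarrow> i \<noteq> j \<Longrightarrow> h \<noteq> j \<Longrightarrow>
    L_rel (Bracket (tAstar h) (Bracket (tA i) (tAstar j)))
          (Bracket (tA j) (Bracket (tAstar i) (tA h)))"
| triple3: "h \<noteq> i \<Longrightarrow> i \<noteq> j \<Longrightarrow> h \<noteq> j \<Longrightarrow>
    L_rel (Bracket (tA j) (Bracket (tAstar i) (tA h)))
          (Bracket (tAstar j) (Bracket (tA i) (tAstar h)))"

quotient_type L = "(complex, generator) lie_term" / "lie_cong L_rel"
  by (rule equivp_lie_cong)

instantiation L :: ab_group_add
begin

lift_definition zero_L :: L is Zero .

lift_definition plus_L :: "L \<Rightarrow> L \<Rightarrow> L" is Add by (rule lie_cong.Add_cong)

lift_definition uminus_L :: "L \<Rightarrow> L" is "Scale (- 1)" by (rule lie_cong.Scale_cong)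

definition minus_L :: "L \<Rightarrow> L \<Rightarrow> L" where "minus_L x y = x + - y"

instance
proof
  fix a b c :: L
  show "a + b + c = a + (b + c)" by transfer (rule lie_cong.Add_assoc)
  show "a + b = b + a" by transfer (rule lie_cong.Add_commute)
  show "0 + a = a" by transfer (rule lie_cong.Add_Zero)
  show "- a + a = 0" by transfer (rule lie_cong.Add_inverse)
  show "a - b = a + - b" by (rule minus_L_def)
qed

end

lift_definition L_scale :: "complex \<Rightarrow> L \<Rightarrow> L" is Scale by (rule lie_cong.Scale_cong)

lift_definition L_bracket :: "L \<Rightarrow> L \<Rightarrow> L" is Bracket by (rule lie_cong.Bracket_cong)

lift_definition A :: "3 \<Rightarrow> L" is tA .

lift_definition Astar :: "3 \<Rightarrow> L" is tAstar .

lemma lie_algebra_L: "lie_algebra L_scale L_bracket"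
proof
  fix x y z :: L and c d :: complex
  show "L_scale c (x + y) = L_scale c x + L_scale c y" by transfer (rule lie_cong.Scale_Add)
  show "L_scale (c + d) x = L_scale c x + L_scale d x" by transfer (rule lie_cong.Scale_add)
  show "L_scale c (L_scale d x) = L_scale (c * d) x" by transfer (rule lie_cong.Scale_Scale)
  show "L_scale 1 x = x" by transfer (rule lie_cong.Scale_one)
  show "L_bracket (x + y) z = L_bracket x z + L_bracket y z"
    by transfer (rule lie_cong.Bracket_Add_left)
  show "L_bracket x (y + z) = L_bracket x y + L_bracket x z"
    by transfer (rule lie_cong.Bracket_Add_right)
  show "L_bracket (L_scale c x) y = L_scale c (L_bracket x y)"
    by transfer (rule lie_cong.Bracket_Scale_left)
  show "L_bracket x (L_scale c y) = L_scale c (L_bracket x y)"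
    by transfer (rule lie_cong.Bracket_Scale_right)
  show "L_bracket x x = 0" by transfer (rule lie_cong.Bracket_self)
  show "L_bracket x (L_bracket y z) + L_bracket y (L_bracket z x) + L_bracket z (L_bracket x y) = 0"
    by transfer (rule lie_cong.Jacobi)
qed

text \<open>The universal property of the presentation.\<close>

theorem L_universal:
  assumes "lie_algebra sc br"
    and R: "\<And>s t. L_rel s t \<Longrightarrow> eval_term sc br a s = eval_term sc br a t"
  shows "\<exists>!f. lie_hom L_scale L_bracket sc br f \<and>
    (\<forall>i. f (A i) = a (GenA i)) \<and> (\<forall>i. f (Astar i) = a (GenAstar i))"
proof -
  interpret M: lie_algebra sc br by fact
  interpret LL: lie_algebra L_scale L_bracket by (rule lie_algebra_L)
  define f where "f x = eval_term sc br a (rep_L x)" for x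
  have f_abs: "f (abs_L t) = eval_term sc br a t" for t
    unfolding f_def
    by (rule M.eval_term_cong[OF _ R])
      (use Quotient3_L in \<open>auto intro: rep_abs_rsp_left simp: Quotient3_def lie_cong.refl\<close>)
  have surj: "\<exists>t. x = abs_L t" for x
    by (metis Quotient3_abs_rep Quotient3_L)
  have f_zero: "f 0 = 0" by (simp add: zero_L.abs_eq f_abs)
  have "lie_hom L_scale L_bracket sc br f"
  proof
    fix x y c
    obtain s t where [simp]: "x = abs_L s" "y = abs_L t" using surj by metis
    show "f (x + y) = f x + f y" by (simp add: plus_L.abs_eq f_abs)
    show "f (L_scale c x) = sc c (f x)" by (simp add: L_scale.abs_eq f_abs)
    show "f (L_bracket x y) = br (f x) (f y)" by (simp add: L_bracket.abs_eq f_abs)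
  qed
  moreover have "f (A i) = a (GenA i)" "f (Astar i) = a (GenAstar i)" for i
    by (simp_all add: A_def Astar_def f_abs)
  moreover have "g = f"
    if g: "lie_hom L_scale L_bracket sc br g" "\<forall>i. g (A i) = a (GenA i)"
      "\<forall>i. g (Astar i) = a (GenAstar i)" for g
  proof
    interpret g: lie_hom L_scale L_bracket sc br g by fact
    have "g (abs_L t) = eval_term sc br a t" for t
    proof (induction t)
      case Zero
      show ?case using g.zero by (simp add: zero_L.abs_eq)
    next
      case (Gen x)
      show ?case using g(2,3) by (cases x) (auto simp: A_def Astar_def)
    next
      case (Add s t)
      then show ?case using g.add[of "abs_L s" "abs_L t"] by (simp add: plus_L.abs_eq)
    next
      case (Scale c t)
      then show ?case using g.scale[of c "abs_L t"] by (simp add: L_scale.abs_eq)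
    next
      case (Bracket s t)
      then show ?case using g.hom_bracket[of "abs_L s" "abs_L t"] by (simp add: L_bracket.abs_eq)
    qed
    then show "g x = f x" for x using surj[of x] f_abs by metis
  qed
  ultimately show ?thesis by blast
qed

section \<open>The Lie algebra \<open>sl\<^sub>4(\<complex>)\<close>\<close>

definition mat_scale :: "complex \<Rightarrow> complex^'n^'n \<Rightarrow> complex^'n^'n" where
  "mat_scale c M = (\<chi> i j. c * M $ i $ j)"

definition mat_bracket :: "complex^'n^'n \<Rightarrow> complex^'n^'n \<Rightarrow> complex^'n^'n" where
  "mat_bracket M N = M ** N - N ** M"

definition sl4 :: "(complex^4^4) set" where
  "sl4 = {M. trace M = 0}"

lemma lie_algebra_mat: "lie_algebra mat_scale (mat_bracket :: complex^'n^'n \<Rightarrow> _)"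
proof
  fix M N P :: "complex^'n^'n" and c d :: complex
  have scale_mult: "mat_scale c M ** N = mat_scale c (M ** N)"
    and mult_scale: "M ** mat_scale c N = mat_scale c (M ** N)" for c M N
    by (simp_all add: vec_eq_iff mat_scale_def matrix_matrix_mult_def sum_distrib_left algebra_simps)
  have scale_diff: "mat_scale c (M - N) = mat_scale c M - mat_scale c N" for c M N
    by (simp add: vec_eq_iff mat_scale_def algebra_simps)
  have sub: "(M - N) ** P = M ** P - N ** P" "P ** (M - N) = P ** M - P ** N"
    and add: "(M + N) ** P = M ** P + N ** P" "P ** (M + N) = P ** M + P ** N" for M N P :: "complex^'n^'n"
    by (simp_all add: vec_eq_iff matrix_matrix_mult_def algebra_simps sum.distrib sum_subtractf)
  show "mat_scale c (M + N) = mat_scale c M + mat_scale c N"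
    "mat_scale (c + d) M = mat_scale c M + mat_scale d M"
    "mat_scale c (mat_scale d M) = mat_scale (c * d) M"
    "mat_scale 1 M = M"
    by (simp_all add: vec_eq_iff mat_scale_def algebra_simps)
  show "mat_bracket (M + N) P = mat_bracket M P + mat_bracket N P"
    "mat_bracket M (N + P) = mat_bracket M N + mat_bracket M P"
    by (simp_all add: mat_bracket_def add)
  show "mat_bracket (mat_scale c M) N = mat_scale c (mat_bracket M N)"
    "mat_bracket M (mat_scale c N) = mat_scale c (mat_bracket M N)"
    by (simp_all add: mat_bracket_def scale_mult mult_scale scale_diff)
  show "mat_bracket M M = 0" by (simp add: mat_bracket_def)
  show "mat_bracket M (mat_bracket N P) + mat_bracket N (mat_bracket P M)
      + mat_bracket P (mat_bracket M N) = 0"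
    by (simp add: mat_bracket_def sub matrix_mul_assoc)
qed

lemma lie_subalgebra_sl4: "lie_algebra.lie_subalgebra mat_scale mat_bracket sl4"
proof -
  interpret lie_algebra mat_scale "mat_bracket :: complex^4^4 \<Rightarrow> _" by (rule lie_algebra_mat)
  have "trace (mat_scale c M) = c * trace M" for c and M :: "complex^4^4"
    by (simp add: trace_def mat_scale_def sum_distrib_left)
  moreover have "trace (0 :: complex^4^4) = 0"
    by (simp add: trace_def)
  ultimately show ?thesis
    by (auto simp: lie_subalgebra_def subspace_def sl4_def mat_bracket_def trace_add trace_sub
        intro: trace_mul_sym)
qed

lemma vector_4 [simp]:
  "(vector [w, x, y, z] :: 'a::zero^4) $ 1 = w"
  "(vector [w, x, y, z] :: 'a::zero^4) $ 2 = x"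
  "(vector [w, x, y, z] :: 'a::zero^4) $ 3 = y"
  "(vector [w, x, y, z] :: 'a::zero^4) $ 4 = z"
  unfolding vector_def by auto

end

theory Submission
  imports Defs
begin

text \<open>In a Lie algebra with elements \<open>a\<^sub>i\<close>, \<open>b\<^sub>i\<close> satisfying the relations, the elements \<open>a\<^sub>i\<close>,
  \<open>b\<^sub>i\<close>, \<open>[a\<^sub>i, b\<^sub>j]\<close> and \<open>[a\<^sub>h, [b\<^sub>i, a\<^sub>j]]\<close> span a subspace that is stable under all \<open>ad a\<^sub>k\<close>.
  The relations and this subspace are unchanged when \<open>a\<close> and \<open>b\<close> are swapped, so it is stable under
  all \<open>ad b\<^sub>k\<close> as well, and therefore it is everything if the \<open>a\<^sub>i\<close>, \<open>b\<^sub>i\<close> generate. By the last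
  relations the elements \<open>[a\<^sub>h, [b\<^sub>i, a\<^sub>j]]\<close> depend only on \<open>i\<close>, which leaves 15 spanning elements.
  The given matrices satisfy the relations, and the resulting homomorphism sends the 15 elements to
  a basis of \<open>sl\<^sub>4\<close>: grouped by the positions of their nonzero entries, they are
  multiples of the rows of \<open>4 \<times> 4\<close> Hadamard matrices.\<close>

section \<open>Consequences of the relations\<close>

context lie_algebra
begin

lemma bracket_zero_right [simp]: "bracket x 0 = 0"
  using bracket_add_right[of x 0 0] by simp

lemma bracket_zero_left [simp]: "bracket 0 x = 0"
  using bracket_add_left[of 0 0 x] by simp

lemma bracket_skew: "bracket x y = - bracket y x"
proof -
  have "bracket x y + bracket y x = 0"
    using bracket_self[of "x + y"] bracket_add_left[of x y "x + y"] bracket_add_right[of x x y]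
      bracket_add_right[of y x y]
    by (simp add: bracket_self)
  then show ?thesis by (simp add: eq_neg_iff_add_eq_0)
qed

lemma bracket_minus_right: "bracket x (- y) = - bracket x y"
  using bracket_add_right[of x y "- y"] by (simp add: eq_neg_iff_add_eq_0 add.commute)

text \<open>The Jacobi identity as ad [x,y] = [ad x, ad y]. A subspace stable under ad x and ad y is
  therefore stable under ad [x,y], which carries stability from the generators to all of
  \<open>L\<close>.\<close>

lemma bracket_bracket_left: "bracket (bracket x y) z = bracket x (bracket y z) - bracket y (bracket x z)"
proof -
  have "bracket x (bracket y z) + bracket y (bracket z x) + bracket z (bracket x y) = 0"
    by (rule jacobi)
  moreover have "bracket y (bracket z x) = - bracket y (bracket x z)"
    using bracket_skew[of z x] by (simp add: bracket_minus_right)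
  moreover have "bracket z (bracket x y) = - bracket (bracket x y) z" by (rule bracket_skew)
  ultimately show ?thesis by simp
qed

lemma bracket_left_commute:
  "bracket x y = 0 \<Longrightarrow> bracket x (bracket y z) = bracket y (bracket x z)"
  using bracket_bracket_left[of x y z] by simp

lemma bracket_span_closed:
  assumes "y \<in> span B" and "\<And>y. y \<in> B \<Longrightarrow> bracket x y \<in> span B"
  shows "bracket x y \<in> span B"
  using assms(1)
  by (induction rule: span_induct_alt)
    (auto simp: bracket_add_right bracket_scale_right intro!: span_add span_scale assms(2) span_zero)

end

lemma index_cases: "i \<noteq> j \<Longrightarrow> j = i + 1 \<or> j = i + 2" for i j :: 3
  using exhaust_3[of i] exhaust_3[of j] by auto

section \<open>The relations and the subspace stable under all generators\<close>

locale L_relations = lie_algebra +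
  fixes a b :: "3 \<Rightarrow> 'b"
  assumes a_a: "i \<noteq> j \<Longrightarrow> bracket (a i) (a j) = 0"
    and b_b: "i \<noteq> j \<Longrightarrow> bracket (b i) (b j) = 0"
    and a_b_same: "bracket (a i) (b i) = 0"
    and a_a_b: "i \<noteq> j \<Longrightarrow> bracket (a i) (bracket (a i) (b j)) = scale 4 (b j)"
    and b_b_a: "i \<noteq> j \<Longrightarrow> bracket (b j) (bracket (b j) (a i)) = scale 4 (a i)"
    and triple_swap: "h \<noteq> i \<Longrightarrow> i \<noteq> j \<Longrightarrow> h \<noteq> j \<Longrightarrow>
      bracket (a h) (bracket (b i) (a j)) = bracket (b h) (bracket (a i) (b j))"
    and triple_rev: "h \<noteq> i \<Longrightarrow> i \<noteq> j \<Longrightarrow> h \<noteq> j \<Longrightarrow>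
      bracket (a h) (bracket (b i) (a j)) = bracket (a j) (bracket (b i) (a h))"
begin

definition spanning_set :: "'b set" where
  "spanning_set = range a \<union> range b \<union> {bracket (a i) (b j) | i j. i \<noteq> j}
    \<union> {bracket (a h) (bracket (b i) (a j)) | h i j. h \<noteq> i \<and> i \<noteq> j \<and> h \<noteq> j}"

text \<open>This lets every result about ad \<open>a k\<close> be reused for ad \<open>b k\<close>.
  Reversal of a triple headed by \<open>b\<close> goes through \<open>triple_swap\<close> to a
  triple headed by \<open>a\<close>, then \<open>triple_rev\<close>, then \<open>triple_swap\<close>
  back.\<close>

lemma dual: "L_relations scale bracket b a"
proof
  show "bracket (b i) (a i) = 0" for i
    using bracket_skew[of "b i" "a i"] a_b_same by simp
  show "bracket (b h) (bracket (a i) (b j)) = bracket (b j) (bracket (a i) (b h))"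
    if "h \<noteq> i" "i \<noteq> j" "h \<noteq> j" for h i j
    using that triple_swap triple_rev by metis
qed (use a_a b_b a_a_b b_b_a triple_swap in auto)

lemma in_span:
  "a i \<in> span spanning_set"
  "b i \<in> span spanning_set"
  "bracket (a i) (b j) \<in> span spanning_set"
  "h \<noteq> i \<Longrightarrow> i \<noteq> j \<Longrightarrow> h \<noteq> j \<Longrightarrow> bracket (a h) (bracket (b i) (a j)) \<in> span spanning_set"
proof -
  show "bracket (a i) (b j) \<in> span spanning_set"
    by (cases "i = j") (auto simp: a_b_same spanning_set_def span_zero intro!: span_base)
  show "h \<noteq> i \<Longrightarrow> i \<noteq> j \<Longrightarrow> h \<noteq> j \<Longrightarrow> bracket (a h) (bracket (b i) (a j)) \<in> span spanning_set"
    unfolding spanning_set_def by (rule span_base) blast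
qed (simp_all add: spanning_set_def span_base)

text \<open>All \<open>a i\<close> commute, so ad \<open>a k\<close> can be moved past any ad
  \<open>a h\<close> until it meets a \<open>b\<close>. On \<open>[a i, b j]\<close> this gives
  \<open>4 b j\<close> for \<open>k = i\<close>, zero for \<open>k = j\<close>, and minus a triple
  for the third index.\<close>

lemma bracket_a_spanning:
  assumes "y \<in> spanning_set"
  shows "bracket (a k) y \<in> span spanning_set"
proof -
  have aa: "bracket (a i) (a j) = 0" for i j
    by (cases "i = j") (simp_all add: a_a bracket_self)
  consider (a) i where "y = a i" | (b) i where "y = b i"
    | (ab) i j where "i \<noteq> j" "y = bracket (a i) (b j)"
    | (triple) h i j where "h \<noteq> i" "i \<noteq> j" "h \<noteq> j" "y = bracket (a h) (bracket (b i) (a j))"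
    using assms unfolding spanning_set_def by blast
  then show ?thesis
  proof cases
    case a
    then show ?thesis by (simp add: aa span_zero)
  next
    case b
    then show ?thesis by (simp add: in_span)
  next
    case ab
    consider "k = i" | "k = j" | "k \<noteq> i" "k \<noteq> j" by blast
    then show ?thesis
    proof cases
      case 1
      then show ?thesis using ab by (simp add: a_a_b in_span span_scale)
    next
      case 2
      then have "bracket (a k) y = 0"
        using ab bracket_left_commute[OF aa, of k i "b j"] by (simp add: a_b_same)
      then show ?thesis by (simp add: span_zero)
    next
      case 3
      have "bracket (a k) y = - bracket (a k) (bracket (b j) (a i))"
        using ab bracket_skew[of "a i" "b j"] by (simp add: bracket_minus_right)
      then show ?thesis using 3 ab in_span(4)[of k j i] by (simp add: span_neg)
    qed
  next
    case triple
    \<comment> \<open>Covers a triple whose outer index equals \<open>k\<close>: moving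
      \<open>a q\<close> outermost leaves the square of ad \<open>a p\<close> on \<open>b i\<close>,
      which is multiplication by 4, so the result is \<open>- 4 [a q, b i]\<close>.\<close>
    have ad_square: "bracket (a p) (bracket (a p) (bracket (b i) (a q))) \<in> span spanning_set"
      if "p \<noteq> i" for p q
    proof -
      have "bracket (a p) (bracket (a p) (bracket (b i) (a q)))
          = - bracket (a p) (bracket (a p) (bracket (a q) (b i)))"
        using bracket_skew[of "b i" "a q"] by (simp add: bracket_minus_right)
      also have "\<dots> = - scale 4 (bracket (a q) (b i))"
        using that bracket_left_commute[OF aa, of p q]
        by (simp add: a_a_b bracket_scale_right)
      finally show ?thesis by (simp add: in_span span_neg span_scale)
    qed
    have "k = h \<or> k = j \<or> k = i"
      using triple exhaust_3[of h] exhaust_3[of i] exhaust_3[of j] exhaust_3[of k] by auto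
    then consider "k = h" | "k = j" | "k = i" by blast
    then show ?thesis
    proof cases
      case 1
      then show ?thesis using triple ad_square by simp
    next
      case 2
      \<comment> \<open>Reversing the triple brings \<open>a j\<close> to the outside and reduces to
        the previous case.\<close>
      then show ?thesis using triple ad_square[of j h] by (simp add: triple_rev[of h i j])
    next
      case 3
      \<comment> \<open>Here ad \<open>a i\<close> moves inward past \<open>a h\<close> and
        \<open>a j\<close> and ends at \<open>[a i, b i] = 0\<close>.\<close>
      have "bracket (a i) (bracket (a h) (bracket (a j) (b i))) = 0"
        by (simp add: bracket_left_commute[OF aa, of i] a_b_same)
      then have "bracket (a k) y = 0"
        using 3 triple bracket_skew[of "b i" "a j"] by (simp add: bracket_minus_right)
      then show ?thesis by (simp add: span_zero)
    qed
  qed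
qed

lemma bracket_a_span: "y \<in> span spanning_set \<Longrightarrow> bracket (a k) y \<in> span spanning_set"
  using bracket_span_closed bracket_a_spanning by blast

lemma dual_spanning_subset: "L_relations.spanning_set bracket b a \<subseteq> span spanning_set"
proof -
  interpret dual: L_relations scale bracket b a by (rule dual)
  have "bracket (b i) (a j) \<in> span spanning_set" for i j
    using in_span(3)[of j i] bracket_skew[of "b i" "a j"] by (simp add: span_neg)
  moreover have "bracket (b h) (bracket (a i) (b j)) \<in> span spanning_set"
    if "h \<noteq> i" "i \<noteq> j" "h \<noteq> j" for h i j
    using that in_span(4)[of h i j] by (simp add: triple_swap)
  ultimately show ?thesis
    unfolding dual.spanning_set_def by (auto simp: in_span(1,2))
qed

text \<open>This is \<open>bracket_a_span\<close> for the exchanged families. It speaks of the same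
  subspace because \<open>dual_spanning_subset\<close>, applied to both orders of the families,
  gives both inclusions of the spans.\<close>

lemma bracket_b_span:
  assumes "y \<in> span spanning_set"
  shows "bracket (b k) y \<in> span spanning_set"
proof -
  interpret dual: L_relations scale bracket b a by (rule dual)
  have "span spanning_set = span dual.spanning_set"
    using dual_spanning_subset dual.dual_spanning_subset by (simp add: span_eq)
  then show ?thesis using assms dual.bracket_a_span by simp
qed

text \<open>Indices are added cyclically, so that \<open>i\<close>, \<open>i + 1\<close>, \<open>i + 2\<close> are the three elements of
  \<^typ>\<open>3\<close>.\<close>

definition comb :: "(3 \<Rightarrow> 'a) \<Rightarrow> (3 \<Rightarrow> 'a) \<Rightarrow> (3 \<Rightarrow> 'a) \<Rightarrow> (3 \<Rightarrow> 'a) \<Rightarrow> (3 \<Rightarrow> 'a) \<Rightarrow> 'b" where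
  "comb p q r s t = (\<Sum>i\<in>UNIV. scale (p i) (a i) + scale (q i) (b i)
    + scale (r i) (bracket (a i) (b (i + 1))) + scale (s i) (bracket (a i) (b (i + 2)))
    + scale (t i) (bracket (a (i + 1)) (bracket (b i) (a (i + 2)))))"

lemma subspace_comb: "subspace {comb p q r s t | p q r s t. True}"
proof (rule subspaceI)
  have "0 = comb (\<lambda>_. 0) (\<lambda>_. 0) (\<lambda>_. 0) (\<lambda>_. 0) (\<lambda>_. 0)" by (simp add: comb_def)
  then show "0 \<in> {comb p q r s t | p q r s t. True}" by blast
next
  fix x y assume "x \<in> {comb p q r s t | p q r s t. True}" "y \<in> {comb p q r s t | p q r s t. True}"
  then obtain p q r s t p' q' r' s' t' where "x = comb p q r s t" "y = comb p' q' r' s' t'" by blast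
  then have "x + y = comb (\<lambda>i. p i + p' i) (\<lambda>i. q i + q' i) (\<lambda>i. r i + r' i) (\<lambda>i. s i + s' i)
      (\<lambda>i. t i + t' i)"
    by (simp add: comb_def scale_left_distrib sum.distrib algebra_simps)
  then show "x + y \<in> {comb p q r s t | p q r s t. True}" by blast
next
  fix c x assume "x \<in> {comb p q r s t | p q r s t. True}"
  then obtain p q r s t where "x = comb p q r s t" by blast
  then have "scale c x = comb (\<lambda>i. c * p i) (\<lambda>i. c * q i) (\<lambda>i. c * r i) (\<lambda>i. c * s i) (\<lambda>i. c * t i)"
    by (simp add: comb_def scale_sum_right scale_right_distrib)
  then show "scale c x \<in> {comb p q r s t | p q r s t. True}" by blast
qed

text \<open>Kronecker deltas as coefficients produce each spanning element. Only existence of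
  coefficients is obtained; their uniqueness for \<open>L\<close> is read off from the matrices, see
  \<open>comb_mat_inj\<close>.\<close>

lemma span_spanning_set_comb:
  assumes "x \<in> span spanning_set"
  obtains p q r s t where "x = comb p q r s t"
proof -
  let ?S = "{comb p q r s t | p q r s t. True}"
  have delta: "scale (if j = i then 1 else 0) x = (if j = i then x else 0)" for i j :: 3 and x
    by simp
  have a: "a i \<in> ?S" for i
  proof -
    have "a i = comb (\<lambda>j. if j = i then 1 else 0) (\<lambda>_. 0) (\<lambda>_. 0) (\<lambda>_. 0) (\<lambda>_. 0)"
      by (simp add: comb_def delta)
    then show ?thesis by blast
  qed
  have b: "b i \<in> ?S" for i
  proof -
    have "b i = comb (\<lambda>_. 0) (\<lambda>j. if j = i then 1 else 0) (\<lambda>_. 0) (\<lambda>_. 0) (\<lambda>_. 0)"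
      by (simp add: comb_def delta)
    then show ?thesis by blast
  qed
  have ab: "bracket (a i) (b j) \<in> ?S" if "i \<noteq> j" for i j
  proof -
    have "bracket (a i) (b (i + 1))
        = comb (\<lambda>_. 0) (\<lambda>_. 0) (\<lambda>j. if j = i then 1 else 0) (\<lambda>_. 0) (\<lambda>_. 0)"
      "bracket (a i) (b (i + 2))
        = comb (\<lambda>_. 0) (\<lambda>_. 0) (\<lambda>_. 0) (\<lambda>j. if j = i then 1 else 0) (\<lambda>_. 0)"
      by (simp_all add: comb_def delta)
    then show ?thesis using index_cases[OF that] by blast
  qed
  have triple: "bracket (a h) (bracket (b i) (a j)) \<in> ?S" if "h \<noteq> i" "i \<noteq> j" "h \<noteq> j" for h i j
  proof -
    \<comment> \<open>The outer indices \<open>h\<close>, \<open>j\<close> are \<open>i + 1\<close>,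
      \<open>i + 2\<close> in some order, and \<open>triple_rev\<close> allows either order.\<close>
    have "bracket (a h) (bracket (b i) (a j)) = bracket (a (i + 1)) (bracket (b i) (a (i + 2)))"
      using that index_cases[of i h] index_cases[of i j] triple_rev[of h i j] by auto
    also have "\<dots> = comb (\<lambda>_. 0) (\<lambda>_. 0) (\<lambda>_. 0) (\<lambda>_. 0) (\<lambda>j. if j = i then 1 else 0)"
      by (simp add: comb_def delta)
    finally show ?thesis by blast
  qed
  have "spanning_set \<subseteq> ?S"
    unfolding spanning_set_def using a b ab triple by blast
  then show ?thesis using span_minimal[OF _ subspace_comb] assms that by blast
qed

end

section \<open>The spanning set of \<open>\<bbbL>\<close>\<close>

lemma L_induct [case_names zero A Astar add scale bracket]:
  assumes "P 0" "\<And>i. P (A i)" "\<And>i. P (Astar i)" "\<And>x y. P x \<Longrightarrow> P y \<Longrightarrow> P (x + y)"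
    "\<And>c x. P x \<Longrightarrow> P (L_scale c x)" "\<And>x y. P x \<Longrightarrow> P y \<Longrightarrow> P (L_bracket x y)"
  shows "P x"
proof -
  have "P (abs_L t)" for t
  proof (induction t)
    case Zero
    then show ?case using assms(1) by (simp add: zero_L.abs_eq)
  next
    case (Gen g)
    then show ?case using assms(2,3) by (cases g) (simp_all add: A.abs_eq Astar.abs_eq)
  next
    case (Add s t)
    then show ?case using assms(4) by (metis plus_L.abs_eq)
  next
    case (Scale c t)
    then show ?case using assms(5) by (metis L_scale.abs_eq)
  next
    case (Bracket s t)
    then show ?case using assms(6) by (metis L_bracket.abs_eq)
  qed
  then show ?thesis by (metis Quotient3_L Quotient3_abs_rep)
qed

interpretation L: L_relations L_scale L_bracket A Astar
proof -
  interpret lie_algebra L_scale L_bracket by (rule lie_algebra_L)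
  show "L_relations L_scale L_bracket A Astar"
  proof
    fix h i j :: 3
    show "L_bracket (A i) (Astar i) = 0"
      by transfer (intro lie_cong.rel L_rel.intros)
    assume ij: "i \<noteq> j"
    then show "L_bracket (A i) (A j) = 0"
      by transfer (intro lie_cong.rel L_rel.intros)
    show "L_bracket (Astar i) (Astar j) = 0"
      using ij by transfer (intro lie_cong.rel L_rel.intros)
    show "L_bracket (A i) (L_bracket (A i) (Astar j)) = L_scale 4 (Astar j)"
      using ij by transfer (intro lie_cong.rel L_rel.intros)
    show "L_bracket (Astar j) (L_bracket (Astar j) (A i)) = L_scale 4 (A i)"
      using ij by transfer (intro lie_cong.rel L_rel.intros)
    assume hij: "h \<noteq> i" "h \<noteq> j"
    show 1: "L_bracket (A h) (L_bracket (Astar i) (A j)) = L_bracket (Astar h) (L_bracket (A i) (Astar j))"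
      using ij hij by transfer (intro lie_cong.rel L_rel.triple1)
    have "L_bracket (Astar h) (L_bracket (A i) (Astar j)) = L_bracket (A j) (L_bracket (Astar i) (A h))"
      using ij hij by transfer (intro lie_cong.rel L_rel.triple2)
    with 1 show "L_bracket (A h) (L_bracket (Astar i) (A j)) = L_bracket (A j) (L_bracket (Astar i) (A h))"
      by simp
  qed
qed

text \<open>The induction proves membership of \<open>x\<close> together with stability of the span
  under ad \<open>x\<close>. For a bracket \<open>[x,y]\<close>, membership is stability under ad
  \<open>x\<close> applied to \<open>y\<close>, and stability is
  \<open>bracket_bracket_left\<close>.\<close>

lemma L_span: "x \<in> L.span L.spanning_set"
proof -
  have "x \<in> L.span L.spanning_set \<and> (\<forall>y\<in>L.span L.spanning_set. L_bracket x y \<in> L.span L.spanning_set)"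
    by (induction x rule: L_induct)
      (auto simp: L.bracket_add_left L.bracket_scale_left L.bracket_bracket_left L.in_span
        L.bracket_a_span L.bracket_b_span
        intro: L.span_zero L.span_add L.span_scale L.span_diff)
  then show ?thesis by blast
qed

section \<open>The matrices\<close>

definition mat_gen :: "generator \<Rightarrow> complex^4^4" where
  "mat_gen g = (case g of
      GenA i \<Rightarrow>
        if i = 1 then vector [vector [0, 1, 0, 0], vector [1, 0, 0, 0],
                              vector [0, 0, 0, 1], vector [0, 0, 1, 0]]
        else if i = 2 then vector [vector [0, 0, 1, 0], vector [0, 0, 0, 1],
                                   vector [1, 0, 0, 0], vector [0, 1, 0, 0]]
        else vector [vector [0, 0, 0, 1], vector [0, 0, 1, 0],
                     vector [0, 1, 0, 0], vector [1, 0, 0, 0]]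
    | GenAstar i \<Rightarrow>
        if i = 1 then vector [vector [1, 0, 0, 0], vector [0, 1, 0, 0],
                              vector [0, 0, - 1, 0], vector [0, 0, 0, - 1]]
        else if i = 2 then vector [vector [1, 0, 0, 0], vector [0, - 1, 0, 0],
                                   vector [0, 0, 1, 0], vector [0, 0, 0, - 1]]
        else vector [vector [1, 0, 0, 0], vector [0, - 1, 0, 0],
                     vector [0, 0, - 1, 0], vector [0, 0, 0, 1]])"

section \<open>Entrywise calculus of 4 x 4 matrices and verification of the relations\<close>

lemma vector_4_eq_iff:
  "(vector [w, x, y, z] :: 'a::zero^4) = vector [w', x', y', z']
    \<longleftrightarrow> w = w' \<and> x = x' \<and> y = y' \<and> z = z'"
  by (simp add: vec_eq_iff forall_4)

lemma vector_4_eq_0_iff: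
  "(vector [w, x, y, z] :: 'a::zero^4) = 0 \<longleftrightarrow> w = 0 \<and> x = 0 \<and> y = 0 \<and> z = 0"
  by (simp add: vec_eq_iff forall_4)

lemma vector_4_add:
  "(vector [w, x, y, z] :: 'a::monoid_add^4) + vector [w', x', y', z']
    = vector [w + w', x + x', y + y', z + z']"
  by (simp add: vec_eq_iff forall_4)

lemma mat_scale_vector_4:
  "mat_scale c (vector [vector [x11, x12, x13, x14], vector [x21, x22, x23, x24],
       vector [x31, x32, x33, x34], vector [x41, x42, x43, x44]])
   = (vector [vector [c * x11, c * x12, c * x13, c * x14], vector [c * x21, c * x22, c * x23, c * x24],
       vector [c * x31, c * x32, c * x33, c * x34],
       vector [c * x41, c * x42, c * x43, c * x44]] :: complex^4^4)"
  by (simp add: mat_scale_def vec_eq_iff forall_4)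

text \<open>As a rewrite rule this turns nested brackets of explicit matrices into explicit
  matrices, so each relation becomes arithmetic on entries.\<close>

lemma mat_bracket_vector_4:
  "mat_bracket
     (vector [vector [x11, x12, x13, x14], vector [x21, x22, x23, x24],
       vector [x31, x32, x33, x34], vector [x41, x42, x43, x44]])
     (vector [vector [y11, y12, y13, y14], vector [y21, y22, y23, y24],
       vector [y31, y32, y33, y34], vector [y41, y42, y43, y44]])
   = (vector [
     vector [
       x11 * y11 + x12 * y21 + x13 * y31 + x14 * y41
       - (y11 * x11 + y12 * x21 + y13 * x31 + y14 * x41),
       x11 * y12 + x12 * y22 + x13 * y32 + x14 * y42
       - (y11 * x12 + y12 * x22 + y13 * x32 + y14 * x42),
       x11 * y13 + x12 * y23 + x13 * y33 + x14 * y43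
       - (y11 * x13 + y12 * x23 + y13 * x33 + y14 * x43),
       x11 * y14 + x12 * y24 + x13 * y34 + x14 * y44
       - (y11 * x14 + y12 * x24 + y13 * x34 + y14 * x44)],
     vector [
       x21 * y11 + x22 * y21 + x23 * y31 + x24 * y41
       - (y21 * x11 + y22 * x21 + y23 * x31 + y24 * x41),
       x21 * y12 + x22 * y22 + x23 * y32 + x24 * y42
       - (y21 * x12 + y22 * x22 + y23 * x32 + y24 * x42),
       x21 * y13 + x22 * y23 + x23 * y33 + x24 * y43
       - (y21 * x13 + y22 * x23 + y23 * x33 + y24 * x43),
       x21 * y14 + x22 * y24 + x23 * y34 + x24 * y44
       - (y21 * x14 + y22 * x24 + y23 * x34 + y24 * x44)],
     vector [
       x31 * y11 + x32 * y21 + x33 * y31 + x34 * y41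
       - (y31 * x11 + y32 * x21 + y33 * x31 + y34 * x41),
       x31 * y12 + x32 * y22 + x33 * y32 + x34 * y42
       - (y31 * x12 + y32 * x22 + y33 * x32 + y34 * x42),
       x31 * y13 + x32 * y23 + x33 * y33 + x34 * y43
       - (y31 * x13 + y32 * x23 + y33 * x33 + y34 * x43),
       x31 * y14 + x32 * y24 + x33 * y34 + x34 * y44
       - (y31 * x14 + y32 * x24 + y33 * x34 + y34 * x44)],
     vector [
       x41 * y11 + x42 * y21 + x43 * y31 + x44 * y41
       - (y41 * x11 + y42 * x21 + y43 * x31 + y44 * x41),
       x41 * y12 + x42 * y22 + x43 * y32 + x44 * y42
       - (y41 * x12 + y42 * x22 + y43 * x32 + y44 * x42),
       x41 * y13 + x42 * y23 + x43 * y33 + x44 * y43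
       - (y41 * x13 + y42 * x23 + y43 * x33 + y44 * x43),
       x41 * y14 + x42 * y24 + x43 * y34 + x44 * y44
       - (y41 * x14 + y42 * x24 + y43 * x34 + y44 * x44)]] :: complex^4^4)"
  by (simp add: mat_bracket_def matrix_matrix_mult_def vec_eq_iff forall_4 sum_4)

lemmas mat_4_simps = vector_4_eq_iff vector_4_eq_0_iff vector_4_add mat_scale_vector_4
  mat_bracket_vector_4

lemma eval_L_rel:
  assumes "L_rel s t"
  shows "eval_term mat_scale mat_bracket mat_gen s = eval_term mat_scale mat_bracket mat_gen t"
  using assms
proof cases
  case (A_A i j)
  then show ?thesis using exhaust_3[of i] exhaust_3[of j]
    by (auto simp: mat_4_simps mat_gen_def)
next
  case (Astar_Astar i j)
  then show ?thesis using exhaust_3[of i] exhaust_3[of j]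
    by (auto simp: mat_4_simps mat_gen_def)
next
  case (A_Astar i)
  then show ?thesis using exhaust_3[of i]
    by (auto simp: mat_4_simps mat_gen_def)
next
  case (A_A_Astar i j)
  then show ?thesis using exhaust_3[of i] exhaust_3[of j]
    by (auto simp: mat_4_simps mat_gen_def)
next
  case (Astar_Astar_A i j)
  then show ?thesis using exhaust_3[of i] exhaust_3[of j]
    by (auto simp: mat_4_simps mat_gen_def)
next
  case (triple1 h i j)
  then show ?thesis using exhaust_3[of h] exhaust_3[of i] exhaust_3[of j]
    by (auto simp: mat_4_simps mat_gen_def)
next
  case (triple2 h i j)
  then show ?thesis using exhaust_3[of h] exhaust_3[of i] exhaust_3[of j]
    by (auto simp: mat_4_simps mat_gen_def)
next
  case (triple3 h j i)
  then show ?thesis using exhaust_3[of h] exhaust_3[of i] exhaust_3[of j]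
    by (auto simp: mat_4_simps mat_gen_def)
qed

section \<open>The homomorphism in coordinates and its bijectivity\<close>

text \<open>This is the image of \<open>comb p q r s t\<close>. For distinct indices the matrices of
  \<open>A i\<close> and \<open>Astar j\<close> anticommute, so \<open>[A i, Astar j]\<close>
  becomes -2 times the product of \<open>Astar j\<close> and \<open>A i\<close>; since the matrices
  of \<open>A (i + 1)\<close> and \<open>A (i + 2)\<close> multiply to that of \<open>A i\<close>,
  the triple becomes -4 times the product of \<open>Astar i\<close> and \<open>A i\<close>. Hence
  \<open>p i\<close>, \<open>r i\<close>, \<open>s i\<close>, \<open>t i\<close> occur exactly on
  the support of \<open>A i\<close>, and \<open>q\<close> on the diagonal.\<close>

definition comb_mat ::
    "(3 \<Rightarrow> complex) \<Rightarrow> (3 \<Rightarrow> complex) \<Rightarrow> (3 \<Rightarrow> complex) \<Rightarrow> (3 \<Rightarrow> complex) \<Rightarrow> (3 \<Rightarrow> complex) \<Rightarrow> complex^4^4"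
  where
  "comb_mat p q r s t = vector
    [vector [q 1 + q 2 + q 3, p 1 - 2 * r 1 - 2 * s 1 - 4 * t 1,
             p 2 - 2 * r 2 - 2 * s 2 - 4 * t 2, p 3 - 2 * r 3 - 2 * s 3 - 4 * t 3],
     vector [p 1 + 2 * r 1 + 2 * s 1 - 4 * t 1, q 1 - q 2 - q 3,
             p 3 - 2 * r 3 + 2 * s 3 + 4 * t 3, p 2 + 2 * r 2 - 2 * s 2 + 4 * t 2],
     vector [p 2 + 2 * r 2 + 2 * s 2 - 4 * t 2, p 3 + 2 * r 3 - 2 * s 3 + 4 * t 3,
             - q 1 + q 2 - q 3, p 1 - 2 * r 1 + 2 * s 1 + 4 * t 1],
     vector [p 3 + 2 * r 3 + 2 * s 3 - 4 * t 3, p 2 - 2 * r 2 + 2 * s 2 + 4 * t 2,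
             p 1 + 2 * r 1 - 2 * s 1 + 4 * t 1, - q 1 - q 2 + q 3]]"

lemma hom_comb:
  assumes "lie_hom L_scale L_bracket mat_scale mat_bracket f"
    and "\<And>i. f (A i) = mat_gen (GenA i)" "\<And>i. f (Astar i) = mat_gen (GenAstar i)"
  shows "f (L.comb p q r s t) = comb_mat p q r s t"
proof -
  interpret f: lie_hom L_scale L_bracket mat_scale mat_bracket f by fact
  show ?thesis
    by (simp add: L.comb_def sum_3 f.add f.scale f.hom_bracket assms(2,3))
      (simp add: comb_mat_def mat_4_simps mat_gen_def)
qed

text \<open>The four entries on the support of one \<open>A i\<close> are, in some order, these four
  forms: a Hadamard sign matrix with columns scaled by 1, 2, 2, 4, invertible in characteristic
  0.\<close>

lemma hadamard_4:
  fixes w x y z w' x' y' z' :: "'a::field_char_0"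
  assumes "w - 2 * x - 2 * y - 4 * z = w' - 2 * x' - 2 * y' - 4 * z'"
    and "w + 2 * x + 2 * y - 4 * z = w' + 2 * x' + 2 * y' - 4 * z'"
    and "w - 2 * x + 2 * y + 4 * z = w' - 2 * x' + 2 * y' + 4 * z'"
    and "w + 2 * x - 2 * y + 4 * z = w' + 2 * x' - 2 * y' + 4 * z'"
  shows "w = w' \<and> x = x' \<and> y = y' \<and> z = z'"
  using assms by algebra

lemma comb_mat_inj:
  assumes "comb_mat p q r s t = comb_mat p' q' r' s' t'"
  shows "p = p' \<and> q = q' \<and> r = r' \<and> s = s' \<and> t = t'"
proof -
  note eqs = assms[unfolded comb_mat_def vector_4_eq_iff]
  \<comment> \<open>The first diagonal entry plus the entry at position \<open>i + 1\<close>,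
    counted in 1 to 4, is twice \<open>q i\<close>.\<close>
  have "q 1 = q' 1 \<and> q 2 = q' 2 \<and> q 3 = q' 3"
    using eqs by algebra
  moreover have "p i = p' i \<and> r i = r' i \<and> s i = s' i \<and> t i = t' i" for i
    using exhaust_3[of i] eqs
      hadamard_4[of "p i" "r i" "s i" "t i" "p' i" "r' i" "s' i" "t' i"]
    by (elim disjE) simp_all
  ultimately show ?thesis by (simp add: fun_eq_iff forall_3)
qed

lemma comb_mat_surj:
  assumes "M \<in> sl4"
  shows "\<exists>p q r s t. M = comb_mat p q r s t"
proof -
  \<comment> \<open>The witnesses invert the Hadamard blocks: signed sums over the support of
    \<open>A i\<close>, divided by 4 times the column scales 1, 2, 2, 4, that is by 4, 8, 8,
    16.\<close>
  have "M = comb_mat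
    (\<lambda>i. if i = 1 then (M $ 1 $ 2 + M $ 2 $ 1 + M $ 3 $ 4 + M $ 4 $ 3) / 4
      else if i = 2 then (M $ 1 $ 3 + M $ 2 $ 4 + M $ 3 $ 1 + M $ 4 $ 2) / 4
      else (M $ 1 $ 4 + M $ 2 $ 3 + M $ 3 $ 2 + M $ 4 $ 1) / 4)
    (\<lambda>i. (M $ 1 $ 1 + (if i = 1 then M $ 2 $ 2 else if i = 2 then M $ 3 $ 3 else M $ 4 $ 4)) / 2)
    (\<lambda>i. if i = 1 then (- M $ 1 $ 2 + M $ 2 $ 1 - M $ 3 $ 4 + M $ 4 $ 3) / 8
      else if i = 2 then (- M $ 1 $ 3 + M $ 2 $ 4 + M $ 3 $ 1 - M $ 4 $ 2) / 8
      else (- M $ 1 $ 4 - M $ 2 $ 3 + M $ 3 $ 2 + M $ 4 $ 1) / 8)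
    (\<lambda>i. if i = 1 then (- M $ 1 $ 2 + M $ 2 $ 1 + M $ 3 $ 4 - M $ 4 $ 3) / 8
      else if i = 2 then (- M $ 1 $ 3 - M $ 2 $ 4 + M $ 3 $ 1 + M $ 4 $ 2) / 8
      else (- M $ 1 $ 4 + M $ 2 $ 3 - M $ 3 $ 2 + M $ 4 $ 1) / 8)
    (\<lambda>i. if i = 1 then (- M $ 1 $ 2 - M $ 2 $ 1 + M $ 3 $ 4 + M $ 4 $ 3) / 16
      else if i = 2 then (- M $ 1 $ 3 + M $ 2 $ 4 - M $ 3 $ 1 + M $ 4 $ 2) / 16
      else (- M $ 1 $ 4 + M $ 2 $ 3 + M $ 3 $ 2 - M $ 4 $ 1) / 16)"
  proof -
    have "M $ 1 $ 1 + M $ 2 $ 2 + M $ 3 $ 3 + M $ 4 $ 4 = 0"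
      using assms by (simp add: sl4_def trace_def sum_4)
    \<comment> \<open>Trace zero matters on the diagonal, where three coefficients \<open>q\<close>
      must produce four entries.\<close>
    then have M44: "M $ 4 $ 4 = - M $ 1 $ 1 - M $ 2 $ 2 - M $ 3 $ 3" by algebra
    show ?thesis
      by (simp add: vec_eq_iff forall_4 comb_mat_def M44, simp add: field_simps)
  qed
  then show ?thesis by blast
qed

theorem lemma3p6:
  shows "\<exists>f :: L \<Rightarrow> complex^4^4.
    lie_isomorphism L_scale L_bracket mat_scale mat_bracket sl4 f \<and>
    f (A 1) = vector [vector [0, 1, 0, 0],
                      vector [1, 0, 0, 0],
                      vector [0, 0, 0, 1],
                      vector [0, 0, 1, 0]] \<and>
    f (A 2) = vector [vector [0, 0, 1, 0],
                      vector [0, 0, 0, 1],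
                      vector [1, 0, 0, 0],
                      vector [0, 1, 0, 0]] \<and>
    f (A 3) = vector [vector [0, 0, 0, 1],
                      vector [0, 0, 1, 0],
                      vector [0, 1, 0, 0],
                      vector [1, 0, 0, 0]] \<and>
    f (Astar 1) = vector [vector [1, 0, 0, 0],
                          vector [0, 1, 0, 0],
                          vector [0, 0, -1, 0],
                          vector [0, 0, 0, -1]] \<and>
    f (Astar 2) = vector [vector [1, 0, 0, 0],
                          vector [0, -1, 0, 0],
                          vector [0, 0, 1, 0],
                          vector [0, 0, 0, -1]] \<and>
    f (Astar 3) = vector [vector [1, 0, 0, 0],
                          vector [0, -1, 0, 0],
                          vector [0, 0, -1, 0],
                          vector [0, 0, 0, 1]]"
proof -
  obtain f where hom: "lie_hom L_scale L_bracket mat_scale mat_bracket f"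
    and A: "\<And>i. f (A i) = mat_gen (GenA i)" and Astar: "\<And>i. f (Astar i) = mat_gen (GenAstar i)"
    using L_universal[OF lie_algebra_mat eval_L_rel] by blast
  interpret f: lie_hom L_scale L_bracket mat_scale mat_bracket f by (rule hom)
  note f_comb = hom_comb[OF hom A Astar]
  have comb: "\<exists>p q r s t. x = L.comb p q r s t" for x
    using L.span_spanning_set_comb[OF L_span] by metis
  \<comment> \<open>Elements with equal images have equal coefficients, because
    \<open>comb_mat\<close> determines them; hence the elements agree.\<close>
  have "inj f"
  proof (rule injI)
    fix x y assume "f x = f y"
    moreover obtain p q r s t where x: "x = L.comb p q r s t" using comb by blast
    moreover obtain p' q' r' s' t' where y: "y = L.comb p' q' r' s' t'" using comb by blast
    ultimately show "x = y" using comb_mat_inj by (metis f_comb)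
  qed
  moreover have "range f = sl4"
  proof
    have "comb_mat p q r s t \<in> sl4" for p q r s t
      by (simp add: sl4_def trace_def sum_4 comb_mat_def)
    then show "range f \<subseteq> sl4" using comb f_comb by (metis image_subsetI)
    show "sl4 \<subseteq> range f" using comb_mat_surj f_comb by (metis rangeI subsetI)
  qed
  ultimately have "lie_isomorphism L_scale L_bracket mat_scale mat_bracket sl4 f"
    by unfold_locales (simp_all add: lie_subalgebra_sl4 bij_betw_def)
  then show ?thesis
    by (intro exI[of _ f]) (simp add: A Astar mat_gen_def)
qed

end
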